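(* For all $n\ge1$, $k\ge0$ and $\vec\beta\in\mathbb{N}^{l-1}$, $$Q_{n,k,\vec{\beta}}=\sum_{\pi}F_{n,\mathrm{DES}_{\geq2}(\pi)},$$ the sum being over all $\pi\in C_l\wr\mathfrak{S}_n$ with $\mathrm{inv}_{<2}(\pi)=k$ and $\vec{\mathrm{col}}(\pi)=\vec{\beta}$.
   Context: For $S\subseteq[n-1]$, $F_{n,S}=\sum x_{i_1}\cdots x_{i_n}$ over $i_1\ge\cdots\ge i_n\ge1$ with $i_j>i_{j+1}$ whenever $j\in S$. $C_l\wr\mathfrak{S}_n$ is the set of words $\pi=\pi_1\cdots\pi_n$ with $\pi_i=|\pi_i|^{\epsilon_i}$, $\epsilon_i\in\{0,\dots,l-1\}$, $|\pi_1|\cdots|\pi_n|\in\mathfrak{S}_n$; $\vec{\mathrm{col}}(\pi)=(\mathrm{col}_1(\pi),\dots,\mathrm{col}_{l-1}(\pi))$ with $\mathrm{col}_m(\pi)=|\{i:\epsilon_i=m\}|$. $\mathrm{DES}_{\ge2}(\pi)=\{i\in[n-1]:|\pi_i|>|\pi_{i+1}|\text{ and either }\epsilon_i\ne0\text{ or }|\pi_i|-|\pi_{i+1}|\ge2\}$; $\mathrm{inv}_{<2}(\pi)=|\{(i,j):i<j,\ \epsilon_i=0,\ |\pi_i|-|\pi_j|=1\}|$. For the other side: $\mathcal{B}$ is the alphabet of letters $u^m$ ($u\ge1$, $0\le m\le l-1$; $m$-colored) and barred letters $\overline{u^0}$ ($u\ge1$; $0$-colored), each with absolute value $u$ and weight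 $x_u$. A colored necklace is a primitive circular word over $\mathcal{B}$ (read clockwise, up to rotation) such that every barred letter is followed by a letter of lesser or equal absolute value, every $0$-colored unbarred letter is followed by a letter of greater or equal absolute value, and no necklace of length one is a single barred letter; a colored ornament is a finite multiset of colored necklaces with weight the product of the weights of its letters. $Q_{n,k,\vec\beta}$ is the sum of the weights of all colored ornaments with $n$ letters, exactly $k$ barred letters, and exactly $\beta_m$ $m$-colored letters for each $m\in[l-1]$ (by Hyatt's colored ornament interpretation this equals the paper's $\sum_{\pi}F_{n,\mathrm{DEX}(\pi)}$ over $\pi$ with $\mathrm{exc}(\pi)=k$, $\vec{\mathrm{col}}(\pi)=\vec\beta$). *)

theory Defs
  imports Main "HOL-Library.Multiset"
begin

text \<open>Identity of formal power series in x_1, x_2, ... is expressed coefficientwise: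
  for every exponent vector alpha (alpha u = exponent of x_u).\<close>

text \<open>Coefficient of x^alpha in F_{n,S}: number of sequences i_1 >= ... >= i_n >= 1,
  strict at positions j in S (1-based), with content alpha.\<close>
definition Fcoeff :: "nat \<Rightarrow> nat set \<Rightarrow> (nat \<Rightarrow> nat) \<Rightarrow> nat" where
  "Fcoeff n S \<alpha> = card {i :: nat list. length i = n
      \<and> (\<forall>j. Suc j < n \<longrightarrow> i ! j \<ge> i ! Suc j \<and> (Suc j \<in> S \<longrightarrow> i ! j > i ! Suc j))
      \<and> (\<forall>j<n. i ! j \<ge> 1)
      \<and> (\<forall>u. count (mset i) u = \<alpha> u)}"

text \<open>A colored permutation is a list of pairs (|pi_i|, eps_i).\<close>
definition cperms :: "nat \<Rightarrow> nat \<Rightarrow> (nat \<times> nat) list set" where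
  "cperms l n = {\<pi>. length \<pi> = n \<and> distinct (map fst \<pi>) \<and> set (map fst \<pi>) = {1..n}
                     \<and> (\<forall>p\<in>set \<pi>. snd p < l)}"

definition col :: "nat \<Rightarrow> (nat \<times> nat) list \<Rightarrow> nat" where
  "col m \<pi> = length (filter (\<lambda>p. snd p = m) \<pi>)"

text \<open>1-based positions i in [n-1]: entries pi!(i-1), pi!i.\<close>
definition DES_ge2 :: "(nat \<times> nat) list \<Rightarrow> nat set" where
  "DES_ge2 \<pi> = {i \<in> {1..<length \<pi>}. fst (\<pi> ! (i - 1)) > fst (\<pi> ! i)
      \<and> (snd (\<pi> ! (i - 1)) \<noteq> 0 \<or> fst (\<pi> ! (i - 1)) - fst (\<pi> ! i) \<ge> 2)}"

definition inv_lt2 :: "(nat \<times> nat) list \<Rightarrow> nat" where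
  "inv_lt2 \<pi> = card {(i, j). i < j \<and> j < length \<pi> \<and> snd (\<pi> ! i) = 0
      \<and> fst (\<pi> ! i) = fst (\<pi> ! j) + 1}"

text \<open>A letter is (absolute value u, color m, barred?).\<close>
type_synonym letter = "nat \<times> nat \<times> bool"

definition labs :: "letter \<Rightarrow> nat" where "labs c = fst c"
definition lcol :: "letter \<Rightarrow> nat" where "lcol c = fst (snd c)"
definition lbar :: "letter \<Rightarrow> bool" where "lbar c = snd (snd c)"

definition valid_letter :: "nat \<Rightarrow> letter \<Rightarrow> bool" where
  "valid_letter l c \<longleftrightarrow> labs c \<ge> 1 \<and> lcol c < l \<and> (lbar c \<longrightarrow> lcol c = 0)"

definition follows_ok :: "letter \<Rightarrow> letter \<Rightarrow> bool" where
  "follows_ok a b \<longleftrightarrow> (lbar a \<longrightarrow> labs b \<le> labs a)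
      \<and> (lcol a = 0 \<and> \<not> lbar a \<longrightarrow> labs a \<le> labs b)"

definition primitive_word :: "'a list \<Rightarrow> bool" where
  "primitive_word w \<longleftrightarrow> w \<noteq> [] \<and> \<not> (\<exists>v k. k \<ge> 2 \<and> w = concat (replicate k v))"

definition necklace_word :: "nat \<Rightarrow> letter list \<Rightarrow> bool" where
  "necklace_word l w \<longleftrightarrow> primitive_word w \<and> (\<forall>c\<in>set w. valid_letter l c)
      \<and> (\<forall>i<length w. follows_ok (w ! i) (w ! ((i + 1) mod length w)))
      \<and> \<not> (length w = 1 \<and> lbar (hd w))"

definition necklace_of :: "'a list \<Rightarrow> 'a list set" where
  "necklace_of w = range (\<lambda>i. rotate i w)"

definition colored_necklace :: "nat \<Rightarrow> letter list set \<Rightarrow> bool" where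
  "colored_necklace l N \<longleftrightarrow> (\<exists>w. necklace_word l w \<and> N = necklace_of w)"

text \<open>Number of letters satisfying P in a necklace (independent of representative).\<close>
definition neck_count :: "(letter \<Rightarrow> bool) \<Rightarrow> letter list set \<Rightarrow> nat" where
  "neck_count P N = length (filter P (SOME w. w \<in> N))"

definition orn_count :: "(letter \<Rightarrow> bool) \<Rightarrow> letter list set multiset \<Rightarrow> nat" where
  "orn_count P Orn = sum_mset (image_mset (neck_count P) Orn)"

definition Qcoeff :: "nat \<Rightarrow> nat \<Rightarrow> nat \<Rightarrow> (nat \<Rightarrow> nat) \<Rightarrow> (nat \<Rightarrow> nat) \<Rightarrow> nat" where
  "Qcoeff l n k \<beta> \<alpha> = card {Orn. (\<forall>N\<in>#Orn. colored_necklace l N)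
      \<and> orn_count (\<lambda>_. True) Orn = n
      \<and> orn_count lbar Orn = k
      \<and> (\<forall>m\<in>{1..<l}. orn_count (\<lambda>c. lcol c = m) Orn = \<beta> m)
      \<and> (\<forall>u. orn_count (\<lambda>c. labs c = u) Orn = \<alpha> u)}"

end

theory Submission
  imports Defs
begin

text \<open>Within a block of equal \<open>i\<close>-values, a colored permutation without \<open>DES_ge2\<close>-descents is a
  concatenation of decreasing runs of consecutive integers, and only \<open>0\<close>-colored entries may descend.
  Hence a pair \<open>(\<pi>, i)\<close> is determined by the letters \<open>i\<^sub>j\<close> with color \<open>\<epsilon>\<^sub>j\<close> listed by decreasing \<open>|\<pi>\<^sub>j|\<close>,
  where \<open>v\<close> is barred when it is \<open>0\<close>-colored and precedes \<open>v - 1\<close> in \<open>\<pi>\<close>. The words arising in this way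
  (banners) satisfy the necklace conditions linearly and end in an unbarred letter. For a suitable order
  of the letters, a word is a banner iff all its Lyndon factors are, and a Lyndon word is a banner iff
  the circular word it represents is a necklace; so the Chen--Fox--Lyndon factorization turns banners
  into ornaments.\<close>

section \<open>Lyndon words\<close>

lemma primitive_word_rotate_neq:
  assumes "primitive_word w" "0 < j" "j < length w"
  shows "rotate j w \<noteq> w"
proof
  assume "rotate j w = w"
  then have "drop j w @ take j w = take j w @ drop j w"
    using assms by (simp add: rotate_drop_take)
  \<comment> \<open>Commuting words are powers of a common word \<open>zs\<close>; both parts are
    nonempty, so \<open>w\<close> is a power with exponent at least 2.\<close>
  then obtain m n zs where zs: "concat (replicate m zs) = drop j w" "concat (replicate n zs) = take j w"
    using comm_append_are_replicate by blast
  then have "m \<noteq> 0" "n \<noteq> 0"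
    using assms by (auto intro!: gr0I)
  moreover have "w = concat (replicate (n + m) zs)"
    by (simp add: replicate_add zs)
  ultimately show False
    using assms(1) by (auto simp: primitive_word_def dest!: spec[of _ zs] spec[of _ "n + m"])
qed

lemma rotate_inverse: "\<exists>d. rotate d (rotate i w) = w"
proof (cases "length w")
  case (Suc m)
  \<comment> \<open>Here \<open>m\<close> is \<open>length w - 1\<close>, so the two rotations add
    up to a multiple of the length.\<close>
  have "rotate (m * i) (rotate i w) = rotate (length w * i) w"
    by (simp add: rotate_rotate Suc add.commute)
  also have "\<dots> = w"
    by (simp add: rotate_drop_take)
  finally show ?thesis ..
qed simp

lemma rotate_neq_of_rotate:
  assumes "rotate j w \<noteq> w"
  shows "rotate j (rotate i w) \<noteq> rotate i w"
  using assms by (metis rotate_inverse rotate_rotate add.commute)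

lemma necklace_of_rotate: "necklace_of (rotate i w) = necklace_of w"
proof -
  have "rotate j w \<in> range (\<lambda>k. rotate k (rotate i w))" for j
    by (metis rangeI rotate_inverse rotate_rotate)
  then show ?thesis
    by (auto simp: necklace_of_def rotate_rotate)
qed

lemma self_in_necklace_of: "w \<in> necklace_of w"
  unfolding necklace_of_def by (metis rangeI rotate0 id_apply)

lemma necklace_of_eq_iff: "necklace_of v = necklace_of w \<longleftrightarrow> v \<in> necklace_of w"
proof
  assume "v \<in> necklace_of w"
  then obtain i where "v = rotate i w"
    by (auto simp: necklace_of_def)
  then show "necklace_of v = necklace_of w"
    by (simp add: necklace_of_rotate)
qed (use self_in_necklace_of[of v] in simp)

section \<open>Lyndon words and minimal rotations\<close>

context linorder
begin

abbreviation lex_less :: "'a list \<Rightarrow> 'a list \<Rightarrow> bool" where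
  "lex_less \<equiv> ord.lexordp (<)"

text \<open>The suffix characterization is chosen because factorizations are compared through
  suffixes. In \<open>lex_less\<close> a proper prefix is smaller.\<close>

definition lyndon :: "'a list \<Rightarrow> bool" where
  "lyndon w \<longleftrightarrow> w \<noteq> [] \<and> (\<forall>u v. w = u @ v \<longrightarrow> u \<noteq> [] \<longrightarrow> v \<noteq> [] \<longrightarrow> lex_less w v)"

interpretation lex: linorder lexordp_eq lex_less
  by (rule lexordp_linorder)

lemma lexordp_append_iff: "lex_less (u @ v) (u @ w) \<longleftrightarrow> lex_less v w"
  using lexordp_append_leftI lexordp_append_leftD by blast

text \<open>The comparison is decided at a position inside both words, so appended letters cannot
  change it.\<close>

lemma lexordp_append_not_prefix:
  assumes "lex_less u v" "\<nexists>z. v = u @ z"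
  shows "lex_less (u @ x) (v @ y)"
  using assms unfolding lexordp_iff[of u v] by (auto intro: lexordp_append_left_rightI)

lemma lexordp_append_same_length:
  assumes "lex_less u v" "length u = length v"
  shows "lex_less (u @ x) (v @ y)"
  using assms by (intro lexordp_append_not_prefix) auto

text \<open>In a power with exponent at least 2 the base \<open>v\<close> is a prefix, hence at most
  \<open>w\<close>, and a proper suffix, hence greater than \<open>w\<close>.\<close>

lemma lyndon_primitive:
  assumes "lyndon w"
  shows "primitive_word w"
  unfolding primitive_word_def
proof (intro conjI notI)
  show "w = [] \<Longrightarrow> False"
    using assms by (simp add: lyndon_def)
  assume "\<exists>v k. 2 \<le> k \<and> w = concat (replicate k v)"
  then obtain v k where k: "2 \<le> k" "w = concat (replicate k v)"
    by blast
  define z where "z = concat (replicate (k - 2) v)"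
  have k': "k = Suc (Suc (k - 2))" "k = Suc (k - 2) + 1"
    using k(1) by auto
  have w1: "w = v @ v @ z"
    using k(2) by (subst (asm) k'(1)) (simp add: z_def)
  have w2: "w = (v @ z) @ v"
    using k(2) by (subst (asm) k'(2)) (simp only: replicate_add concat_append, simp add: z_def)
  have "v \<noteq> []"
    using k(2) assms by (auto simp: lyndon_def)
  then have "lex_less w v"
    using assms w2 unfolding lyndon_def by blast
  moreover have "lexordp_eq v w"
    unfolding w1 by (rule lexordp_eq_pref)
  ultimately show False
    by auto
qed

lemma lyndon_hd_le:
  assumes "lyndon w" "c \<in> set w"
  shows "hd w \<le> c"
proof -
  obtain u v where w: "w = u @ c # v"
    using assms(2) by (meson split_list)
  show ?thesis
  proof (cases u)
    case (Cons a u')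
    then have "lex_less w (c # v)"
      using assms(1) w unfolding lyndon_def by blast
    then show ?thesis
      using w Cons by auto
  qed (simp add: w)
qed

text \<open>The one-letter suffix exceeds \<open>w\<close>; with equal first letters it would be a
  proper prefix of \<open>w\<close> and hence smaller.\<close>

lemma lyndon_hd_less_last:
  assumes "lyndon w" "length w \<noteq> 1"
  shows "hd w < last w"
proof -
  have "w \<noteq> []"
    using assms(1) by (simp add: lyndon_def)
  then have w: "w = butlast w @ [last w]"
    by simp
  moreover have "butlast w \<noteq> []"
    using w assms(2) by (metis One_nat_def append_Nil length_Cons list.size(3))
  ultimately have "lex_less w [last w]"
    using assms(1) unfolding lyndon_def by blast
  then show ?thesis
    using \<open>w \<noteq> []\<close> by (cases w) auto
qed

text \<open>With \<open>w = xy\<close> and \<open>v = yx\<close>, the chain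
  \<open>w < y <= v < x <= w\<close> is circular.\<close>

lemma lyndon_rotate_eq:
  assumes "lyndon v" "lyndon w" "v \<in> necklace_of w"
  shows "v = w"
proof (rule ccontr)
  assume "v \<noteq> w"
  obtain i where i: "v = drop i w @ take i w" "i < length w"
    using assms(2,3) that mod_less_divisor[of "length w"]
    by (auto simp: necklace_of_def lyndon_def rotate_drop_take)
  have "i \<noteq> 0"
    using i \<open>v \<noteq> w\<close> by (cases i) auto
  then have ne: "drop i w \<noteq> []" "take i w \<noteq> []"
    using i(2) by auto
  have "lex_less w (drop i w)"
    using assms(2) ne by (metis lyndon_def append_take_drop_id)
  moreover have "lexordp_eq (drop i w) v"
    unfolding i(1) by (rule lexordp_eq_pref)
  moreover have "lex_less v (take i w)"
    using assms(1) ne i(1) by (metis lyndon_def)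
  moreover have "lexordp_eq (take i w) w"
    by (metis append_take_drop_id lexordp_eq_pref)
  ultimately show False
    by (meson lex.less_le_trans lex.less_asym)
qed

text \<open>Suppose \<open>v < w = uv\<close>. If \<open>v\<close> is not a prefix of
  \<open>w\<close>, the rotation \<open>vu\<close> is already smaller than \<open>w\<close>. If
  \<open>w = vx\<close>, then \<open>w < vu\<close> gives \<open>x < u\<close> with equal lengths,
  and the rotation \<open>xv\<close> is smaller than \<open>w\<close>.\<close>

lemma lyndon_if_minimal_rotation:
  assumes "w \<noteq> []" "\<And>j. 0 < j \<Longrightarrow> j < length w \<Longrightarrow> rotate j w \<noteq> w"
    and min: "\<And>v. v \<in> necklace_of w \<Longrightarrow> lexordp_eq w v"
  shows "lyndon w"
  unfolding lyndon_def
proof (intro conjI allI impI)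
  fix u v assume uv: "w = u @ v" "u \<noteq> []" "v \<noteq> []"
  have vu: "rotate (length u) w = v @ u"
    using uv by (simp add: rotate_append)
  have "v @ u \<noteq> w"
    using assms(2)[of "length u"] uv vu by auto
  moreover have "lexordp_eq w (v @ u)"
    using min[of "v @ u"] vu by (metis necklace_of_def rangeI)
  ultimately have less: "lex_less w (v @ u)"
    by auto
  show "lex_less w v"
  proof (rule ccontr)
    assume "\<not> lex_less w v"
    moreover have "w \<noteq> v"
      using uv by auto
    ultimately have vw: "lex_less v w"
      by auto
    show False
    proof (cases "\<exists>x. w = v @ x")
      case True
      then obtain x where x: "w = v @ x"
        by blast
      then have "lex_less x u"
        using less lexordp_append_iff by simp
      moreover have "length x = length u"
        using x uv by (metis add_left_cancel add.commute length_append)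
      ultimately have "lex_less (x @ v) (u @ v)"
        by (rule lexordp_append_same_length)
      moreover have "lexordp_eq w (x @ v)"
        by (rule min) (metis x necklace_of_def rangeI rotate_append)
      ultimately show False
        using uv by auto
    next
      case False
      then have "lex_less (v @ u) (w @ [])"
        using vw by (intro lexordp_append_not_prefix) auto
      then show False
        using less by auto
    qed
  qed
qed fact

text \<open>There are finitely many rotations, hence a least one; primitivity makes it differ from
  its own nontrivial rotations.\<close>

lemma primitive_word_lyndon_rotation:
  assumes "primitive_word w"
  obtains v where "v \<in> necklace_of w" "lyndon v"
proof -
  have "necklace_of w = (\<lambda>i. rotate i w) ` {..<length w}"
  proof -
    have "rotate i w \<in> (\<lambda>i. rotate i w) ` {..<length w}" for i
      using assms by (intro image_eqI[of _ _ "i mod length w"])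
        (auto simp: primitive_word_def intro: rotate_conv_mod)
    then show ?thesis
      by (auto simp: necklace_of_def)
  qed
  then have fin: "finite (necklace_of w)"
    by simp
  define v where "v = lex.Min (necklace_of w)"
  have v: "v \<in> necklace_of w"
    unfolding v_def using fin self_in_necklace_of[of w] by (intro lex.Min_in) auto
  then obtain i where i: "v = rotate i w"
    by (auto simp: necklace_of_def)
  have "lyndon v"
  proof (rule lyndon_if_minimal_rotation)
    show "v \<noteq> []"
      using assms i by (simp add: primitive_word_def)
    show "rotate j v \<noteq> v" if "0 < j" "j < length v" for j
      using that rotate_neq_of_rotate[of j w i] primitive_word_rotate_neq[OF assms] i by simp
    show "lexordp_eq v x" if "x \<in> necklace_of v" for x
      unfolding v_def using that fin v necklace_of_eq_iff by (intro lex.Min_le) auto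
  qed
  then show ?thesis
    using that v by blast
qed

section \<open>Chen-Fox-Lyndon factorization\<close>

text \<open>The last factor of a Lyndon factorization is the smallest nonempty suffix; both existence and
  uniqueness of the factorization follow by splitting off that suffix.\<close>

lemma lyndon_factorization_last_le_suffix:
  assumes "\<forall>f\<in>set fs. lyndon f" "lyndon g" "sorted_wrt (\<lambda>x y. lexordp_eq y x) (fs @ [g])"
    and "concat fs @ g = u @ v" "v \<noteq> []"
  shows "lexordp_eq g v"
  using assms
proof (induction fs arbitrary: u)
  case Nil
  then show ?case
    by (cases "u = []") (auto simp: lyndon_def intro: lexordp_into_lexordp_eq)
next
  case (Cons f fs)
  show ?case
  proof (cases "length f \<le> length u")
    case True
    then obtain u' where "u = f @ u'"
      using Cons.prems(4) by (auto simp: append_eq_append_conv2)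
    then show ?thesis
      using Cons by auto
  next
    case False
    then obtain f' where f': "f = u @ f'" "f' \<noteq> []" "v = f' @ concat fs @ g"
      using Cons.prems(4) by (auto simp: append_eq_append_conv2)
    then have "lexordp_eq f f'"
      using Cons.prems(1) by (cases "u = []") (auto simp: lyndon_def intro: lexordp_into_lexordp_eq)
    moreover have "lexordp_eq f' v"
      unfolding f'(3) by (rule lexordp_eq_pref)
    moreover have "lexordp_eq g f"
      using Cons.prems(3) by simp
    ultimately show ?thesis
      by (meson lexordp_eq_trans)
  qed
qed

text \<open>The two last factors are nonempty suffixes of the same word, so each is at most the
  other; cancel them and recurse.\<close>

lemma lyndon_factorization_unique:
  assumes "\<forall>f\<in>set fs. lyndon f" "sorted_wrt (\<lambda>x y. lexordp_eq y x) fs"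
    and "\<forall>g\<in>set gs. lyndon g" "sorted_wrt (\<lambda>x y. lexordp_eq y x) gs"
    and "concat fs = concat gs"
  shows "fs = gs"
  using assms
proof (induction fs arbitrary: gs rule: rev_induct)
  case Nil
  then show ?case
    by (cases gs) (auto simp: lyndon_def)
next
  case (snoc f fs)
  have "f \<noteq> []"
    using snoc.prems by (auto simp: lyndon_def)
  then have "gs \<noteq> []"
    using snoc.prems by auto
  then obtain hs h where gs: "gs = hs @ [h]"
    by (metis rev_exhaust)
  have "h \<noteq> []"
    using snoc.prems gs by (auto simp: lyndon_def)
  have "lexordp_eq f h"
    using lyndon_factorization_last_le_suffix[of fs f "concat hs" h] snoc.prems gs \<open>h \<noteq> []\<close> by auto
  moreover have "lexordp_eq h f"
    using lyndon_factorization_last_le_suffix[of hs h "concat fs" f] snoc.prems gs \<open>f \<noteq> []\<close> by auto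
  ultimately have "f = h"
    by simp
  moreover have "fs = hs"
    using snoc.IH[of hs] snoc.prems gs \<open>f = h\<close> by (auto simp: sorted_wrt_append)
  ultimately show ?case
    using gs by simp
qed

lemma lyndon_factorization_exists:
  "\<exists>fs. (\<forall>f\<in>set fs. lyndon f) \<and> sorted_wrt (\<lambda>x y. lexordp_eq y x) fs \<and> concat fs = w"
proof (induction "length w" arbitrary: w rule: less_induct)
  case less
  show ?case
  proof (cases "w = []")
    case True
    then show ?thesis
      by (intro exI[of _ "[]"]) simp
  next
    case False
    define suffixes where "suffixes w = {v. v \<noteq> [] \<and> (\<exists>u. w = u @ v)}" for w :: "'a list"
    have fin: "finite (suffixes w)"
    proof (rule finite_subset)
      show "suffixes w \<subseteq> (\<lambda>i. drop i w) ` {..length w}"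
      proof
        fix v assume "v \<in> suffixes w"
        then obtain u where "w = u @ v"
          by (auto simp: suffixes_def)
        then have "v = drop (length u) w" "length u \<le> length w"
          by auto
        then show "v \<in> (\<lambda>i. drop i w) ` {..length w}"
          by blast
      qed
    qed simp
    \<comment> \<open>The least nonempty suffix is Lyndon, since its suffixes are suffixes of
      \<open>w\<close>; it becomes the last factor.\<close>
    define s where "s = lex.Min (suffixes w)"
    have "s \<in> suffixes w"
      unfolding s_def using False fin by (intro lex.Min_in) (auto simp: suffixes_def)
    then obtain w' where w': "w = w' @ s" "s \<noteq> []"
      by (auto simp: suffixes_def)
    have min: "lexordp_eq s v" if "w = u @ v" "v \<noteq> []" for u v
      unfolding s_def using that fin by (intro lex.Min_le) (auto simp: suffixes_def)
    have "lyndon s"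
      unfolding lyndon_def
    proof (intro conjI allI impI)
      fix u v assume "s = u @ v" "u \<noteq> []" "v \<noteq> []"
      then have "lexordp_eq s v" "s \<noteq> v"
        using min[of "w' @ u" v] w' by auto
      then show "lex_less s v"
        by auto
    qed fact
    obtain fs where fs: "\<forall>f\<in>set fs. lyndon f" "sorted_wrt (\<lambda>x y. lexordp_eq y x) fs" "concat fs = w'"
      using less[of w'] w' by auto
    \<comment> \<open>If \<open>f < s\<close>, then \<open>s <= f @ s\<close> forces
      \<open>s = f @ z\<close>. Cancelling \<open>f\<close> gives \<open>z <= s\<close>, while
      minimality of \<open>s\<close> gives \<open>s <= z\<close>; so \<open>f\<close> would be
      empty.\<close>
    have last: "lexordp_eq s f" if f: "fs = gs @ [f]" for gs f
    proof (rule ccontr)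
      assume "\<not> lexordp_eq s f"
      then have less: "lex_less f s"
        by auto
      have suffix: "w = concat gs @ f @ s"
        using fs f w' by simp
      then have "lexordp_eq s (f @ s)"
        using min w' by blast
      have "\<exists>z. s = f @ z"
      proof (rule ccontr)
        assume "\<nexists>z. s = f @ z"
        then have "lex_less (f @ s) (s @ [])"
          using less by (intro lexordp_append_not_prefix)
        then show False
          using \<open>lexordp_eq s (f @ s)\<close> by auto
      qed
      then obtain z where z: "s = f @ z"
        by blast
      then have "z \<noteq> []"
        using less by auto
      have "f \<noteq> []"
        using fs(1) f by (simp add: lyndon_def)
      have "lexordp_eq z s"
        using \<open>lexordp_eq s (f @ s)\<close> unfolding z
        by (metis lexordp_append_iff lex.not_le)
      moreover have "lexordp_eq s z"
        using min[of "w' @ f" z] w' z \<open>z \<noteq> []\<close> by simp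
      ultimately have "s = z"
        by simp
      then show False
        using z \<open>f \<noteq> []\<close> by auto
    qed
    have "lexordp_eq s f" if "f \<in> set fs" for f
    proof (cases fs rule: rev_cases)
      case (snoc gs g)
      then show ?thesis
        using last[OF snoc] fs(2) that by (auto simp: sorted_wrt_append intro: lexordp_eq_trans)
    qed (use that in simp)
    then show ?thesis
      using fs w' \<open>lyndon s\<close> by (intro exI[of _ "fs @ [s]"]) (auto simp: sorted_wrt_append)
  qed
qed

end

section \<open>Ornaments and banners\<close>

text \<open>Large absolute values come first, and barred letters precede unbarred ones of the same absolute
  value: then the condition imposed on the last letter of a Lyndon word by its cyclic successor says
  exactly that it is unbarred.\<close>

definition letter_less :: "letter \<Rightarrow> letter \<Rightarrow> bool" where
  "letter_less a b \<longleftrightarrow> labs b < labs a \<or> labs a = labs b \<and>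
     (lbar a \<and> \<not> lbar b \<or> lbar a = lbar b \<and> lcol a < lcol b)"

definition letter_le :: "letter \<Rightarrow> letter \<Rightarrow> bool" where
  "letter_le a b \<longleftrightarrow> a = b \<or> letter_less a b"

lemma letter_eqI: "labs a = labs b \<Longrightarrow> lcol a = lcol b \<Longrightarrow> lbar a = lbar b \<Longrightarrow> a = b"
  by (simp add: labs_def lcol_def lbar_def prod_eq_iff)

interpretation letter: linorder letter_le letter_less
proof
  fix x y :: letter
  show "letter_le x y \<or> letter_le y x"
    using letter_eqI[of x y] unfolding letter_le_def letter_less_def by (metis linorder_neqE_nat)
qed (auto simp: letter_le_def letter_less_def)

interpretation letter_lex: linorder "ord.lexordp_eq letter_less" "ord.lexordp letter_less"
  by (rule letter.lexordp_linorder)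

abbreviation nonincreasing :: "letter list list \<Rightarrow> bool" where
  "nonincreasing \<equiv> sorted_wrt (\<lambda>f g. ord.lexordp_eq letter_less g f)"

section \<open>Banners as linear counterparts of necklaces\<close>

definition banner :: "nat \<Rightarrow> letter list \<Rightarrow> bool" where
  "banner l w \<longleftrightarrow> (\<forall>c\<in>set w. valid_letter l c) \<and> successively follows_ok w
     \<and> (w \<noteq> [] \<longrightarrow> \<not> lbar (last w))"

lemma circular_successively_iff:
  assumes "w \<noteq> []"
  shows "(\<forall>i<length w. R (w ! i) (w ! ((i + 1) mod length w))) \<longleftrightarrow>
    successively R w \<and> R (last w) (hd w)" (is "?L \<longleftrightarrow> ?R")
proof
  assume L: ?L
  have "R (w ! i) (w ! Suc i)" if "Suc i < length w" for i
    using L that by (metis Suc_eq_plus1 Suc_lessD mod_less)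
  moreover have "R (last w) (hd w)"
    using L[rule_format, of "length w - 1"] assms by (simp add: last_conv_nth hd_conv_nth)
  ultimately show ?R
    by (simp add: successively_conv_nth)
next
  assume R: ?R
  show ?L
  proof (intro allI impI)
    fix i assume "i < length w"
    then consider "Suc i < length w" | "i = length w - 1"
      by linarith
    then show "R (w ! i) (w ! ((i + 1) mod length w))"
      using R assms by cases (auto simp: successively_conv_nth last_conv_nth hd_conv_nth)
  qed
qed

text \<open>The first letter is the least, so it has the largest absolute value and may follow any
  unbarred last letter. A barred last letter would need a first letter of equal absolute value;
  beyond length one that letter is strictly smaller, so it would be barred with a color below
  0.\<close>

lemma lyndon_necklace_word_iff:
  assumes "letter.lyndon w"
  shows "necklace_word l w \<longleftrightarrow> banner l w"
proof -
  have ne: "w \<noteq> []"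
    using assms by (simp add: letter.lyndon_def)
  have le: "letter_le (hd w) (last w)"
    using letter.lyndon_hd_le[OF assms] ne by simp
  have "\<not> lbar (last w)" if "\<not> (length w = 1 \<and> lbar (hd w))" "follows_ok (last w) (hd w)"
    "valid_letter l (last w)"
  proof
    assume bar: "lbar (last w)"
    then have "length w \<noteq> 1"
      using that(1) by (cases w) auto
    then have "letter_less (hd w) (last w)"
      by (rule letter.lyndon_hd_less_last[OF assms])
    then show False
      using bar that(2,3) by (auto simp: letter_less_def follows_ok_def valid_letter_def)
  qed
  moreover have "follows_ok (last w) (hd w)" if "\<not> lbar (last w)"
    using that le by (auto simp: follows_ok_def letter_le_def letter_less_def)
  moreover have "\<not> (length w = 1 \<and> lbar (hd w))" if "\<not> lbar (last w)"
    using that by (cases w) auto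
  ultimately show ?thesis
    unfolding necklace_word_def banner_def circular_successively_iff[OF ne]
    using ne letter.lyndon_primitive[OF assms] by auto
qed

text \<open>Only the junctions between consecutive factors \<open>f\<close> and \<open>g\<close>
  matter. From \<open>g <= f\<close> follows \<open>hd g <= hd f <= last f\<close>, so an unbarred
  \<open>last f\<close> is always compatible with \<open>hd g\<close>.\<close>

lemma banner_concat_iff:
  assumes "\<forall>f\<in>set fs. letter.lyndon f" "nonincreasing fs"
  shows "banner l (concat fs) \<longleftrightarrow> (\<forall>f\<in>set fs. banner l f)"
  using assms
proof (induction fs)
  case (Cons f fs)
  have IH: "banner l (concat fs) \<longleftrightarrow> (\<forall>f\<in>set fs. banner l f)"
    using Cons by simp
  show ?case
  proof (cases fs)
    case Nil
    then show ?thesis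
      by simp
  next
    case fs: (Cons g gs)
    have f: "letter.lyndon f" "f \<noteq> []" and g: "letter.lyndon g" "g \<noteq> []"
      using Cons.prems fs by (auto simp: letter.lyndon_def)
    have gf: "ord.lexordp_eq letter_less g f"
      using Cons.prems fs by simp
    then have hd_gf: "letter_le (hd g) (hd f)"
      using f g by (cases f; cases g) (auto simp: letter_le_def)
    have hd_f: "letter_le (hd f) (last f)"
      using letter.lyndon_hd_le[OF f(1)] f(2) by simp
    have ok: "follows_ok (last f) (hd g)" if "\<not> lbar (last f)"
      using that hd_gf hd_f by (auto simp: follows_ok_def letter_le_def letter_less_def)
    \<comment> \<open>A barred \<open>last f\<close> forces \<open>hd g = hd f = last f\<close>.
      Then \<open>f\<close> is this single letter, and so is \<open>g\<close>, since a longer word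
      with that first letter exceeds \<open>f\<close>; but \<open>g\<close> ends unbarred.\<close>
    have unbarred: "\<not> lbar (last f)"
      if "follows_ok (last f) (hd g)" "banner l g" "valid_letter l (last f)"
    proof
      assume bar: "lbar (last f)"
      have val: "valid_letter l (hd g)"
        using that(2) g(2) by (simp add: banner_def)
      have "hd g = last f"
        using bar hd_gf hd_f that(1,3) val
        by (intro letter_eqI) (auto simp: follows_ok_def letter_le_def letter_less_def valid_letter_def)
      then have eq: "hd f = last f" "hd g = hd f"
        using hd_gf hd_f by (auto intro: letter.order.antisym)
      then have "length f = 1"
        using letter.lyndon_hd_less_last[OF f(1)] by fastforce
      then have "f = [hd g]"
        using eq(2) by (cases f) auto
      then have "g = [hd g]"
        using gf g(2) by (cases g; cases "tl g") auto
      then have "last g = last f"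
        using \<open>hd g = last f\<close> by (metis last.simps)
      then show False
        using bar that(2) g(2) by (simp add: banner_def)
    qed
    show ?thesis
    proof
      assume L: "banner l (concat (f # fs))"
      then have "banner l (concat fs)" "follows_ok (last f) (hd g)" "valid_letter l (last f)"
        using fs f(2) g(2) by (auto simp: banner_def successively_append_iff)
      then have "\<not> lbar (last f)"
        using unbarred IH fs by simp
      then have "banner l f"
        using L by (auto simp: banner_def successively_append_iff)
      then show "\<forall>f\<in>set (f # fs). banner l f"
        using IH \<open>banner l (concat fs)\<close> by simp
    next
      assume R: "\<forall>f\<in>set (f # fs). banner l f"
      then have "banner l (concat fs)" "follows_ok (last f) (hd g)"
        using IH ok f(2) by (auto simp: banner_def)
      then show "banner l (concat (f # fs))"
        using R fs f(2) g(2) by (auto simp: banner_def successively_append_iff)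
    qed
  qed
qed (simp add: banner_def)

lemma necklace_word_rotate:
  assumes "necklace_word l w" "primitive_word (rotate i w)"
  shows "necklace_word l (rotate i w)"
proof -
  have "follows_ok (rotate i w ! j) (rotate i w ! ((j + 1) mod length w))" if "j < length w" for j
  proof -
    have "w \<noteq> []"
      using that by auto
    then have "(i + j) mod length w < length w"
      by simp
    then have "follows_ok (w ! ((i + j) mod length w)) (w ! (((i + j) mod length w + 1) mod length w))"
      using assms(1) unfolding necklace_word_def by blast
    moreover have "((i + j) mod length w + 1) mod length w = (i + (j + 1) mod length w) mod length w"
      by (simp add: mod_simps)
    ultimately show ?thesis
      using that \<open>w \<noteq> []\<close> by (simp add: nth_rotate)
  qed
  moreover have "hd (rotate i w) = hd w" if "length w = 1"
    using that by (simp add: rotate_length01)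
  ultimately show ?thesis
    using assms unfolding necklace_word_def by auto
qed

text \<open>Each necklace is represented by its Lyndon rotation, for which the cyclic and the linear
  conditions agree.\<close>

lemma colored_necklace_iff:
  "colored_necklace l N \<longleftrightarrow> (\<exists>f. letter.lyndon f \<and> banner l f \<and> N = necklace_of f)"
proof
  assume "colored_necklace l N"
  then obtain w where w: "necklace_word l w" "N = necklace_of w"
    by (auto simp: colored_necklace_def)
  then obtain v where v: "v \<in> necklace_of w" "letter.lyndon v"
    using letter.primitive_word_lyndon_rotation by (auto simp: necklace_word_def)
  then have "necklace_word l v"
    using necklace_word_rotate[OF w(1)] letter.lyndon_primitive by (auto simp: necklace_of_def)
  then show "\<exists>f. letter.lyndon f \<and> banner l f \<and> N = necklace_of f"
    using v w necklace_of_eq_iff lyndon_necklace_word_iff by blast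
qed (use lyndon_necklace_word_iff in \<open>auto simp: colored_necklace_def\<close>)

section \<open>Ornaments as multisets of Lyndon banners\<close>

lemma neck_count_necklace_of: "neck_count P (necklace_of w) = length (filter P w)"
proof -
  have "(SOME v. v \<in> necklace_of w) \<in> necklace_of w"
    using self_in_necklace_of by (rule someI)
  moreover have "length (filter P v) = length (filter P w)" if "v \<in> necklace_of w" for v
  proof -
    have "mset (drop i w @ take i w) = mset w" for i
      by (metis append_take_drop_id mset_append union_commute)
    then have "mset v = mset w"
      using that by (auto simp: necklace_of_def rotate_drop_take simp del: mset_append)
    then show ?thesis
      by (metis mset_filter size_mset)
  qed
  ultimately show ?thesis
    by (simp add: neck_count_def)
qed

lemma orn_count_necklaces:
  "orn_count P (mset (map necklace_of fs)) = length (filter P (concat fs))"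
  by (induction fs) (simp_all add: orn_count_def neck_count_necklace_of)

lemma inj_on_necklace_multiset:
  "inj_on (\<lambda>fs. mset (map necklace_of fs)) {fs. (\<forall>f\<in>set fs. letter.lyndon f) \<and> nonincreasing fs}"
proof (rule inj_onI, clarify)
  fix fs gs
  assume lyn: "\<forall>f\<in>set fs. letter.lyndon f" "\<forall>g\<in>set gs. letter.lyndon g"
    and sorted: "nonincreasing fs" "nonincreasing gs"
    and eq: "mset (map necklace_of fs) = mset (map necklace_of gs)"
  \<comment> \<open>\<open>r\<close> picks the Lyndon representative, unique by
    \<open>lyndon_rotate_eq\<close>. It recovers the multiset of factors from that of the necklaces;
    the ordering then fixes the list.\<close>
  define r where "r N = (SOME f. letter.lyndon f \<and> necklace_of f = N)" for N :: "letter list set"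
  have r: "r (necklace_of f) = f" if "letter.lyndon f" for f
  proof -
    have "letter.lyndon (r (necklace_of f)) \<and> necklace_of (r (necklace_of f)) = necklace_of f"
      unfolding r_def by (rule someI) (use that in blast)
    then show ?thesis
      using that letter.lyndon_rotate_eq necklace_of_eq_iff by blast
  qed
  have "map r (map necklace_of fs) = fs" "map r (map necklace_of gs) = gs"
    using r lyn by (simp_all add: map_idI)
  then have "mset fs = mset gs"
    using eq by (metis mset_map)
  then have "mset (rev fs) = mset (rev gs)"
    by simp
  moreover have "sorted_wrt (ord.lexordp_eq letter_less) (rev fs)"
    "sorted_wrt (ord.lexordp_eq letter_less) (rev gs)"
    using sorted by (simp_all add: sorted_wrt_rev)
  ultimately have "rev fs = rev gs"
    using letter_lex.properties_for_sort by metis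
  then show "fs = gs"
    by simp
qed

lemma Qcoeff_eq_card_banners:
  "Qcoeff l n k \<beta> \<alpha> = card {w. banner l w \<and> length w = n \<and> length (filter lbar w) = k
     \<and> (\<forall>m\<in>{1..<l}. length (filter (\<lambda>c. lcol c = m) w) = \<beta> m)
     \<and> (\<forall>u. length (filter (\<lambda>c. labs c = u) w) = \<alpha> u)}" (is "_ = card ?W")
proof -
  define weight where "weight w \<longleftrightarrow> length w = n \<and> length (filter lbar w) = k
     \<and> (\<forall>m\<in>{1..<l}. length (filter (\<lambda>c. lcol c = m) w) = \<beta> m)
     \<and> (\<forall>u. length (filter (\<lambda>c. labs c = u) w) = \<alpha> u)" for w :: "letter list"
  \<comment> \<open>The set through which both sides are compared: \<open>concat\<close> maps it
    bijectively onto the banners, \<open>?orn\<close> onto the ornaments, and all counts are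
    preserved.\<close>
  define F where "F = {fs. (\<forall>f\<in>set fs. letter.lyndon f) \<and> nonincreasing fs
    \<and> (\<forall>f\<in>set fs. banner l f) \<and> weight (concat fs)}"
  define Orns where "Orns = {Orn. (\<forall>N\<in>#Orn. colored_necklace l N)
      \<and> orn_count (\<lambda>_. True) Orn = n
      \<and> orn_count lbar Orn = k
      \<and> (\<forall>m\<in>{1..<l}. orn_count (\<lambda>c. lcol c = m) Orn = \<beta> m)
      \<and> (\<forall>u. orn_count (\<lambda>c. labs c = u) Orn = \<alpha> u)}"
  let ?orn = "\<lambda>fs. mset (map necklace_of fs)"
  have orn: "?orn fs \<in> Orns \<longleftrightarrow> (\<forall>f\<in>set fs. colored_necklace l (necklace_of f)) \<and> weight (concat fs)" for fs
    unfolding Orns_def weight_def mem_Collect_eq orn_count_necklaces by auto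
  have words: "bij_betw concat F ?W"
  proof (rule bij_betw_imageI)
    show "inj_on concat F"
      using letter.lyndon_factorization_unique by (intro inj_onI) (auto simp: F_def)
    show "concat ` F = ?W"
    proof (intro equalityI subsetI)
      fix w assume w: "w \<in> ?W"
      obtain fs where fs: "\<forall>f\<in>set fs. letter.lyndon f" "nonincreasing fs" "concat fs = w"
        using letter.lyndon_factorization_exists by blast
      then have "fs \<in> F"
        using w banner_concat_iff[of fs] by (auto simp: F_def weight_def)
      then show "w \<in> concat ` F"
        using fs by blast
    qed (auto simp: F_def weight_def banner_concat_iff)
  qed
  have ornaments: "bij_betw ?orn F Orns"
  proof (rule bij_betw_imageI)
    show "inj_on ?orn F"
      by (rule inj_on_subset[OF inj_on_necklace_multiset]) (auto simp: F_def)
    show "?orn ` F = Orns"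
    proof (intro equalityI subsetI)
      fix M assume "M \<in> ?orn ` F"
      then obtain fs where fs: "fs \<in> F" "M = ?orn fs"
        by blast
      then have "\<forall>f\<in>set fs. colored_necklace l (necklace_of f)"
        using colored_necklace_iff unfolding F_def by blast
      then show "M \<in> Orns"
        using orn fs by (simp add: F_def)
    next
      fix M assume M: "M \<in> Orns"
      then have "\<forall>N\<in>#M. \<exists>f. letter.lyndon f \<and> banner l f \<and> N = necklace_of f"
        by (auto simp: Orns_def colored_necklace_iff)
      then obtain r where r: "\<forall>N\<in>#M. letter.lyndon (r N) \<and> banner l (r N) \<and> N = necklace_of (r N)"
        by metis
      obtain xs where "mset xs = image_mset r M"
        using ex_mset by blast
      \<comment> \<open>\<open>sort\<close> is ascending, whereas Lyndon factorizations
        descend.\<close>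
      define fs where "fs = rev (letter_lex.sort xs)"
      have mset: "mset fs = image_mset r M"
        by (simp add: fs_def letter_lex.mset_sort \<open>mset xs = _\<close>)
      have "?orn fs = image_mset necklace_of (image_mset r M)"
        by (simp add: mset)
      also have "\<dots> = image_mset (\<lambda>N. N) M"
        unfolding multiset.map_comp using r by (intro image_mset_cong) simp
      finally have eq: "?orn fs = M"
        by simp
      have "set fs = r ` set_mset M"
        using mset by (metis set_image_mset set_mset_mset)
      moreover have "nonincreasing fs"
        by (simp add: fs_def sorted_wrt_rev)
      moreover have "weight (concat fs)"
        using orn[of fs] M eq by simp
      ultimately have "fs \<in> F"
        using r by (auto simp: F_def)
      then show "M \<in> ?orn ` F"
        using eq by (metis image_eqI)
    qed
  qed
  show ?thesis
    using bij_betw_same_card[OF words] bij_betw_same_card[OF ornaments]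
    by (simp only: Qcoeff_def Orns_def)
qed

section \<open>Banners and colored permutations\<close>

text \<open>A colored permutation together with a sequence contributing to its \<open>F\<close> is encoded as a list of
  triples \<open>(i\<^sub>j, |\<pi>\<^sub>j|, \<epsilon>\<^sub>j)\<close>.\<close>

definition no_drop :: "nat \<times> nat \<times> nat \<Rightarrow> nat \<times> nat \<times> nat \<Rightarrow> bool" where
  "no_drop p q \<longleftrightarrow> fst q \<le> fst p \<and> (fst p = fst q \<longrightarrow> fst (snd q) < fst (snd p) \<longrightarrow>
     snd (snd p) = 0 \<and> fst (snd p) = Suc (fst (snd q)))"

text \<open>The letters of a word are read from right to left, the value \<open>v\<close> being carried by the \<open>v\<close>-th letter
  from the right. A value larger than all present ones can be inserted only at the end of the block of
  entries with its first component, or immediately in front of its predecessor.\<close>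

fun arrange :: "letter list \<Rightarrow> (nat \<times> nat \<times> nat) list" where
  "arrange [] = []"
| "arrange (c # w) =
    (let Q = if lbar c \<and> w \<noteq> [] \<and> labs c = labs (hd w)
       then (\<lambda>p. fst (snd p) \<noteq> length w) else (\<lambda>p. labs c \<le> fst p)
     in takeWhile Q (arrange w) @ (labs c, Suc (length w), lcol c) # dropWhile Q (arrange w))"

section \<open>Shape and values of \<open>arrange\<close>\<close>

lemma arrange_Cons_split:
  obtains A B where "arrange w = A @ B"
    "arrange (c # w) = A @ (labs c, Suc (length w), lcol c) # B"
  by (simp add: Let_def) (metis takeWhile_dropWhile_id)

lemma mset_arrange:
  "mset (map (\<lambda>p. (fst p, snd (snd p))) (arrange w)) = mset (map (\<lambda>c. (labs c, lcol c)) w)"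
proof (induction w)
  case (Cons c w)
  obtain A B where "arrange w = A @ B"
    "arrange (c # w) = A @ (labs c, Suc (length w), lcol c) # B"
    by (rule arrange_Cons_split)
  then show ?case
    using Cons by (simp del: arrange.simps)
qed simp

lemma length_arrange [simp]: "length (arrange w) = length w"
  using mset_arrange by (metis length_map mset_eq_length)

lemma arrange_values:
  "distinct (map (fst \<circ> snd) (arrange w))" "(fst \<circ> snd) ` set (arrange w) = {1..length w}"
proof (induction w)
  case (Cons c w)
  obtain A B where AB: "arrange w = A @ B"
    "arrange (c # w) = A @ (labs c, Suc (length w), lcol c) # B"
    by (rule arrange_Cons_split)
  have "Suc (length w) \<notin> (fst \<circ> snd) ` set (arrange w)"
    unfolding Cons(2) by simp
  then have new: "Suc (length w) \<notin> (fst \<circ> snd) ` set A" "Suc (length w) \<notin> (fst \<circ> snd) ` set B"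
    unfolding AB(1) by (simp_all add: image_Un)
  {
    case 1
    show ?case
      using Cons(1) new unfolding AB by simp
  next
    case 2
    show ?case
      using Cons(2) unfolding AB by (auto simp: image_Un)
  }
qed simp_all

lemma arrange_value_le: "p \<in> set (arrange w) \<Longrightarrow> fst (snd p) \<le> length w"
  using arrange_values(2)[of w] by force

text \<open>The newest entry carries the largest value, so it can be read off and deleted; this
  inverts \<open>arrange\<close> one letter at a time.\<close>

lemma filter_value_arrange_Cons:
  "filter (\<lambda>p. fst (snd p) = Suc (length w)) (arrange (c # w)) = [(labs c, Suc (length w), lcol c)]"
  "filter (\<lambda>p. fst (snd p) \<noteq> Suc (length w)) (arrange (c # w)) = arrange w"
proof -
  obtain A B where AB: "arrange w = A @ B"
    "arrange (c # w) = A @ (labs c, Suc (length w), lcol c) # B"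
    by (rule arrange_Cons_split)
  have "fst (snd p) \<noteq> Suc (length w)" if "p \<in> set A \<union> set B" for p
    using that arrange_value_le[of p w] AB(1) by auto
  then show "filter (\<lambda>p. fst (snd p) = Suc (length w)) (arrange (c # w)) = [(labs c, Suc (length w), lcol c)]"
    "filter (\<lambda>p. fst (snd p) \<noteq> Suc (length w)) (arrange (c # w)) = arrange w"
    unfolding AB by (auto simp: filter_empty_conv filter_id_conv)
qed

lemma hd_in_arrange:
  "w \<noteq> [] \<Longrightarrow> (labs (hd w), length w, lcol (hd w)) \<in> set (arrange w)"
  by (cases w) (simp_all add: Let_def)

lemma value_unique:
  assumes "distinct (map (fst \<circ> snd) P)" "p \<in> set P" "q \<in> set P" "fst (snd p) = fst (snd q)"
  shows "p = q"
  using inj_onD[of "fst \<circ> snd" "set P" p q] assms by (simp add: distinct_map)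

lemma no_drop_sorted:
  assumes "successively no_drop P"
  shows "sorted_wrt (\<lambda>p q. fst q \<le> fst p) P"
proof -
  have "successively (\<lambda>p q. fst q \<le> fst p) P"
    using assms by (rule successively_mono) (simp add: no_drop_def)
  moreover have "transp (\<lambda>p q :: nat \<times> nat \<times> nat. fst q \<le> fst p)"
    by (auto intro: transpI)
  ultimately show ?thesis
    by (simp add: successively_conv_sorted_wrt)
qed

lemma takeWhile_dropWhile_sorted:
  fixes P :: "(nat \<times> 'b) list"
  assumes "sorted_wrt (\<lambda>p q. fst q \<le> fst p) P"
  shows "takeWhile (\<lambda>p. u \<le> fst p) P = filter (\<lambda>p. u \<le> fst p) P"
    "dropWhile (\<lambda>p. u \<le> fst p) P = filter (\<lambda>p. fst p < u) P"
  using assms by (induction P) (auto intro!: filter_True[symmetric] filter_False[symmetric])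

lemma banner_ConsD: "banner l (c # w) \<Longrightarrow> banner l w"
  by (cases w) (auto simp: banner_def)

text \<open>In case \<open>before\<close>, the entry \<open>q\<close> of \<open>hd w\<close> has the
  value preceding the new one, because values count letters from the right. In case
  \<open>at_end\<close>, first components decrease weakly along \<open>arrange w\<close>, so cutting
  at the first one below \<open>labs c\<close> leaves only smaller ones behind.\<close>

lemma arrange_Cons_cases:
  assumes "banner l (c # w)" and succ: "successively no_drop (arrange w)"
  obtains (before) A q B where "lbar c" "w \<noteq> []" "arrange w = A @ q # B"
      "q = (labs c, length w, lcol (hd w))"
      "arrange (c # w) = A @ (labs c, Suc (length w), lcol c) # q # B"
  | (at_end) A B where "\<not> (lbar c \<and> w \<noteq> [] \<and> labs c = labs (hd w))" "arrange w = A @ B"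
      "\<forall>p\<in>set A. labs c \<le> fst p" "\<forall>p\<in>set B. fst p < labs c"
      "arrange (c # w) = A @ (labs c, Suc (length w), lcol c) # B"
proof (cases "lbar c \<and> w \<noteq> [] \<and> labs c = labs (hd w)")
  case True
  let ?q = "(labs c, length w, lcol (hd w))"
  have "?q \<in> set (arrange w)"
    using hd_in_arrange[of w] True by simp
  then obtain A B where AB: "arrange w = A @ ?q # B"
    by (meson split_list)
  have "fst (snd p) \<noteq> length w" if "p \<in> set A" for p
    using arrange_values(1)[of w] that unfolding AB by force
  then have "takeWhile (\<lambda>p. fst (snd p) \<noteq> length w) (arrange w) = A"
    "dropWhile (\<lambda>p. fst (snd p) \<noteq> length w) (arrange w) = ?q # B"
    unfolding AB by (simp_all add: takeWhile_append2 dropWhile_append2)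
  then have "arrange (c # w) = A @ (labs c, Suc (length w), lcol c) # ?q # B"
    using True by simp
  then show thesis
    using before[of A ?q B] True AB by simp
next
  case False
  let ?Q = "\<lambda>p :: nat \<times> nat \<times> nat. labs c \<le> fst p"
  have "arrange (c # w) = takeWhile ?Q (arrange w) @ (labs c, Suc (length w), lcol c) # dropWhile ?Q (arrange w)"
    using False by (simp only: arrange.simps Let_def if_False)
  moreover have "\<forall>p\<in>set (dropWhile ?Q (arrange w)). fst p < labs c"
    unfolding takeWhile_dropWhile_sorted[OF no_drop_sorted[OF succ]] by simp
  moreover have "\<forall>p\<in>set (takeWhile ?Q (arrange w)). labs c \<le> fst p"
    by (auto dest: set_takeWhileD)
  ultimately show thesis
    using at_end[OF False takeWhile_dropWhile_id[symmetric]] by blast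
qed

text \<open>The new value exceeds all others, so its left neighbor cannot drop to it. Its right
  neighbor, if any, is its predecessor, with the new entry 0-colored, or has a smaller first
  component.\<close>

lemma no_drop_arrange: "banner l w \<Longrightarrow> successively no_drop (arrange w)"
proof (induction w)
  case (Cons c w)
  have succ: "successively no_drop (arrange w)"
    using Cons banner_ConsD by blast
  have le: "fst (snd p) \<le> length w" if "p \<in> set (arrange w)" for p
    using that arrange_value_le by blast
  show ?case
    using Cons.prems succ
  proof (cases rule: arrange_Cons_cases)
    case (before A q B)
    have "lcol c = 0"
      using Cons.prems before by (simp add: banner_def valid_letter_def)
    moreover have "fst (snd (last A)) \<le> length w" if "A \<noteq> []"
      using le that before(3) by simp
    ultimately show ?thesis
      using succ unfolding before(5) before(3)
      by (fastforce simp: successively_append_iff successively_Cons no_drop_def before(4))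
  next
    case (at_end A B)
    have "fst (snd (last A)) \<le> length w \<and> labs c \<le> fst (last A)" if "A \<noteq> []"
      using le that at_end(2,3) by simp
    moreover have "fst (hd B) < labs c" if "B \<noteq> []"
      using at_end(4) that by simp
    ultimately show ?thesis
      using succ unfolding at_end(5) at_end(2)
      by (fastforce simp: successively_append_iff successively_Cons no_drop_def)
  qed
qed simp

section \<open>Inversions and bars\<close>

lemma inv_lt2_Cons:
  assumes "distinct (map fst \<pi>)"
  shows "inv_lt2 (p # \<pi>) = (if snd p = 0 \<and> (\<exists>q\<in>set \<pi>. fst p = Suc (fst q)) then 1 else 0) + inv_lt2 \<pi>"
proof -
  let ?I = "\<lambda>\<pi> :: (nat \<times> nat) list. {(i, j). i < j \<and> j < length \<pi> \<and> snd (\<pi> ! i) = 0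
      \<and> fst (\<pi> ! i) = fst (\<pi> ! j) + 1}"
  let ?J = "{j. j < length \<pi> \<and> snd p = 0 \<and> fst p = Suc (fst (\<pi> ! j))}"
  \<comment> \<open>Pairs starting at the new head are separated from the shifted old pairs; by
    distinctness there is at most one of the former.\<close>
  have split: "?I (p # \<pi>) = (\<lambda>j. (0, Suc j)) ` ?J \<union> (\<lambda>(i, j). (Suc i, Suc j)) ` ?I \<pi>"
  proof (intro equalityI subsetI)
    fix x assume "x \<in> ?I (p # \<pi>)"
    then obtain i j where x: "x = (i, Suc j)" "i < Suc j" "j < length \<pi>" "snd ((p # \<pi>) ! i) = 0"
      "fst ((p # \<pi>) ! i) = Suc (fst (\<pi> ! j))"
      by (auto simp: less_Suc_eq_0_disj)
    then show "x \<in> (\<lambda>j. (0, Suc j)) ` ?J \<union> (\<lambda>(i, j). (Suc i, Suc j)) ` ?I \<pi>"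
      by (cases i) (auto simp: image_iff)
  qed auto
  have fin: "finite (?I \<pi>)"
    by (rule finite_subset[of _ "{..length \<pi>} \<times> {..length \<pi>}"]) auto
  have "card (?I (p # \<pi>)) = card ?J + card (?I \<pi>)"
    unfolding split using fin
    by (subst card_Un_disjoint) (auto simp: card_image inj_on_def)
  moreover have "card ?J = (if snd p = 0 \<and> (\<exists>q\<in>set \<pi>. fst p = Suc (fst q)) then 1 else 0)"
  proof (cases "snd p = 0 \<and> (\<exists>q\<in>set \<pi>. fst p = Suc (fst q))")
    case True
    then obtain j where j: "j < length \<pi>" "fst p = Suc (fst (\<pi> ! j))"
      by (auto simp: in_set_conv_nth)
    have "?J = {j}"
      using True j assms nth_eq_iff_index_eq[OF assms] by auto
    then show ?thesis
      using True by simp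
  next
    case False
    then have J: "?J = {}"
      by (auto dest: nth_mem)
    show ?thesis
      unfolding J using False by simp
  qed
  ultimately show ?thesis
    by (simp add: inv_lt2_def)
qed

text \<open>A maximal value is never the smaller member of a counted pair, so inserting it adds only
  a pair that it starts itself.\<close>

lemma inv_lt2_insert_max:
  assumes "distinct (map fst (\<pi> @ p # \<sigma>))" "\<forall>q\<in>set (\<pi> @ \<sigma>). fst q < fst p"
  shows "inv_lt2 (\<pi> @ p # \<sigma>) =
    (if snd p = 0 \<and> (\<exists>q\<in>set \<sigma>. fst p = Suc (fst q)) then 1 else 0) + inv_lt2 (\<pi> @ \<sigma>)"
  using assms
proof (induction \<pi>)
  case (Cons r \<pi>)
  have "inv_lt2 (\<pi> @ p # \<sigma>) =
    (if snd p = 0 \<and> (\<exists>q\<in>set \<sigma>. fst p = Suc (fst q)) then 1 else 0) + inv_lt2 (\<pi> @ \<sigma>)"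
    using Cons by simp
  moreover have "(\<exists>q\<in>set (\<pi> @ p # \<sigma>). fst r = Suc (fst q)) \<longleftrightarrow> (\<exists>q\<in>set (\<pi> @ \<sigma>). fst r = Suc (fst q))"
    using Cons.prems(2) by auto
  moreover have "distinct (map fst (\<pi> @ p # \<sigma>))" "distinct (map fst (\<pi> @ \<sigma>))"
    using Cons.prems(1) by auto
  ultimately show ?case
    by (simp only: append_Cons inv_lt2_Cons)
qed (simp add: inv_lt2_Cons)

lemma inv_lt2_arrange: "banner l w \<Longrightarrow> inv_lt2 (map snd (arrange w)) = length (filter lbar w)"
proof (induction w)
  case Nil
  then show ?case
    by (simp add: inv_lt2_def)
next
  case (Cons c w)
  have IH: "inv_lt2 (map snd (arrange w)) = length (filter lbar w)"
    using Cons banner_ConsD by blast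
  have dist: "distinct (map fst (map snd (arrange (c # w))))"
    using arrange_values(1)[of "c # w"] by simp
  have less: "\<forall>p\<in>set (map snd (arrange w)). fst p < Suc (length w)"
    using arrange_value_le[of _ w] by (auto simp: less_Suc_eq_le)
  have succ: "successively no_drop (arrange w)"
    using Cons.prems banner_ConsD no_drop_arrange by blast
  have col: "lbar c \<Longrightarrow> lcol c = 0"
    using Cons.prems by (simp add: banner_def valid_letter_def)
  have step: "inv_lt2 (map snd (arrange (c # w))) =
      (if lcol c = 0 \<and> (\<exists>q\<in>set B. length w = fst (snd q)) then 1 else 0) + inv_lt2 (map snd (arrange w))"
    if "arrange w = A @ B" "arrange (c # w) = A @ (labs c, Suc (length w), lcol c) # B" for A B
    using inv_lt2_insert_max[of "map snd A" "(Suc (length w), lcol c)" "map snd B"] dist less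
    unfolding that by simp
  \<comment> \<open>At the end of a block the predecessor stands to the right iff
    \<open>labs (hd w) < labs c\<close>. For color 0, \<open>follows_ok\<close> makes this
    equivalent to a bar, as a barred \<open>c\<close> with equality is excluded here.\<close>
  have bar_iff: "(lcol c = 0 \<and> (\<exists>q\<in>set B. length w = fst (snd q))) \<longleftrightarrow> lbar c"
    if "arrange w = A @ B" "\<not> (lbar c \<and> w \<noteq> [] \<and> labs c = labs (hd w))"
      "\<forall>p\<in>set A. labs c \<le> fst p" "\<forall>p\<in>set B. fst p < labs c" for A B
  proof (cases "w = []")
    case True
    then show ?thesis
      using that(1) Cons.prems by (simp add: banner_def)
  next
    case False
    let ?q = "(labs (hd w), length w, lcol (hd w))"
    have q: "?q \<in> set (A @ B)"
      using hd_in_arrange[OF False] that(1) by simp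
    have "(\<exists>r\<in>set B. length w = fst (snd r)) \<longleftrightarrow> ?q \<in> set B"
    proof
      assume "\<exists>r\<in>set B. length w = fst (snd r)"
      then obtain r where r: "r \<in> set B" "fst (snd r) = fst (snd ?q)"
        by auto
      then have "r = ?q"
        using value_unique[OF arrange_values(1)[of w]] q that(1) by fastforce
      then show "?q \<in> set B"
        using r(1) by simp
    qed force
    moreover have "?q \<in> set B \<longleftrightarrow> labs (hd w) < labs c"
      using q that(3,4) by fastforce
    moreover have "follows_ok c (hd w)"
      using Cons.prems False by (auto simp: banner_def successively_Cons)
    ultimately show ?thesis
      using that(2) False col unfolding follows_ok_def by linarith
  qed
  show ?case
    using Cons.prems succ
  proof (cases rule: arrange_Cons_cases)
    case (before A q B)
    then have "\<exists>r\<in>set (q # B). length w = fst (snd r)"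
      by simp
    then show ?thesis
      using step[OF before(3,5)] before(1) col IH by simp
  next
    case (at_end A B)
    show ?thesis
      using bar_iff[OF at_end(2,1,3,4)] step[OF at_end(2,5)] IH by simp
  qed
qed

section \<open>Bijectivity of \<open>arrange\<close>\<close>

lemma arrange_inject:
  assumes "banner l v" "banner l w" "arrange v = arrange w"
  shows "v = w"
  using assms
proof (induction v arbitrary: w)
  case Nil
  then show ?case
    by (metis length_0_conv length_arrange)
next
  case (Cons c v)
  have "length w = Suc (length v)"
    using Cons.prems(3) by (metis length_Cons length_arrange)
  then obtain d u where w: "w = d # u" "length u = length v"
    by (auto simp: length_Suc_conv)
  have "arrange v = arrange u"
    using filter_value_arrange_Cons(2)[of v c] filter_value_arrange_Cons(2)[of u d] Cons.prems(3) w by simp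
  then have vu: "v = u"
    using Cons w banner_ConsD by blast
  have "labs c = labs d" "lcol c = lcol d"
    using filter_value_arrange_Cons(1)[of v c] filter_value_arrange_Cons(1)[of u d] Cons.prems(3) w by auto
  \<comment> \<open>Bars are not stored in \<open>arrange\<close>; equal inversion counts and equal
    tails force equal bars on the first letters.\<close>
  moreover have "length (filter lbar (c # v)) = length (filter lbar (d # u))"
    using inv_lt2_arrange Cons.prems w by metis
  then have "lbar c = lbar d"
    using vu by (simp split: if_splits)
  ultimately show ?case
    using vu w letter_eqI by blast
qed

text \<open>Delete the largest value, apply induction, and choose the bar of the new first letter
  according to where that value stood.\<close>

lemma arrange_surj:
  assumes "distinct (map (fst \<circ> snd) P)" "(fst \<circ> snd) ` set P = {1..n}" "successively no_drop P"
    and "\<forall>p\<in>set P. 1 \<le> fst p \<and> snd (snd p) < l"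
  shows "\<exists>w. banner l w \<and> arrange w = P"
  using assms
proof (induction n arbitrary: P)
  case 0
  then show ?case
    by (intro exI[of _ "[]"]) (simp add: banner_def)
next
  case (Suc n)
  have "Suc n \<in> (fst \<circ> snd) ` set P"
    using Suc.prems(2) by simp
  then obtain x where x: "x \<in> set P" "fst (snd x) = Suc n"
    by auto
  then obtain A B where P: "P = A @ x # B"
    by (meson split_list)
  obtain u e where x_eq: "x = (u, Suc n, e)"
    using x(2) by (cases x) auto
  have vals: "fst (snd p) \<le> n" if "p \<in> set (A @ B)" for p
  proof -
    have "p \<in> set P"
      using that P by auto
    then have "(fst \<circ> snd) p \<in> {1..Suc n}"
      using Suc.prems(2) by blast
    moreover have "(fst \<circ> snd) p \<noteq> (fst \<circ> snd) x"
      using that Suc.prems(1) P by (auto simp: image_iff)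
    ultimately show ?thesis
      using x(2) by auto
  qed
  have x_last: "no_drop (last A) x" if "A \<noteq> []"
    using Suc.prems(3) that P by (simp add: successively_append_iff)
  have x_hd: "no_drop x (hd B)" if "B \<noteq> []"
    using Suc.prems(3) that P by (simp add: successively_append_iff successively_Cons)
  \<comment> \<open>If all three entries share a block, \<open>x\<close> can only be followed by
    \<open>n\<close>, the largest remaining value, so deleting \<open>x\<close> creates no
    drop.\<close>
  have "no_drop (last A) (hd B)" if "A \<noteq> []" "B \<noteq> []"
    using x_last x_hd vals[of "last A"] vals[of "hd B"] that x_eq by (auto simp: no_drop_def)
  then have "successively no_drop (A @ B)"
    using Suc.prems(3) P by (auto simp: successively_append_iff successively_Cons)
  moreover have "(fst \<circ> snd) ` set (A @ B) = {1..n}"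
  proof -
    have "insert (Suc n) ((fst \<circ> snd) ` set (A @ B)) = insert (Suc n) {1..n}"
      using Suc.prems(2) x(2) P by (simp add: atLeastAtMostSuc_conv)
    moreover have "Suc n \<notin> (fst \<circ> snd) ` set (A @ B)"
      using vals by force
    ultimately show ?thesis
      by (metis Suc_n_not_le_n atLeastAtMost_iff insert_ident)
  qed
  ultimately obtain v where v: "banner l v" "arrange v = A @ B"
    using Suc.IH[of "A @ B"] Suc.prems P by auto
  have len: "length v = n"
  proof -
    have "{1..length v} = {1..n}"
      using arrange_values(2)[of v] \<open>(fst \<circ> snd) ` set (A @ B) = {1..n}\<close> v(2) by simp
    then show ?thesis
      by (metis card_atLeastAtMost diff_Suc_1)
  qed
  have bounds: "1 \<le> u" "e < l"
    using Suc.prems(4) P x_eq by auto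
  show ?case
  proof (cases "B \<noteq> [] \<and> fst (hd B) = u")
    case True
    \<comment> \<open>Within its block the maximal \<open>x\<close> may precede only the value
      \<open>n\<close>, and only with color 0: this is the insertion rule for a barred letter with
      the absolute value of \<open>hd v\<close>.\<close>
    then have e: "e = 0" "fst (snd (hd B)) = n"
      using x_hd x_eq vals[of "hd B"] by (auto simp: no_drop_def)
    have "n \<in> (fst \<circ> snd) ` set (A @ B)"
      using True e(2) by (force intro: image_eqI[of _ _ "hd B"])
    then have "v \<noteq> []"
      using v(2) by auto
    then have "(labs (hd v), length v, lcol (hd v)) \<in> set (A @ B)"
      using hd_in_arrange v(2) by metis
    then have hd: "hd B = (labs (hd v), length v, lcol (hd v))"
      using value_unique[OF arrange_values(1)[of v], of "hd B"] v(2) True e(2) len by simp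
    define c :: letter where "c = (u, 0, True)"
    have c: "labs c = u" "lcol c = 0" "lbar c"
      by (simp_all add: c_def labs_def lcol_def lbar_def)
    have "banner l (c # v)"
      using v(1) c bounds e \<open>v \<noteq> []\<close> hd True
      by (auto simp: banner_def successively_Cons valid_letter_def follows_ok_def)
    moreover have "arrange (c # v) = P"
    proof -
      have "fst (snd p) \<noteq> n" if "p \<in> set A" for p
        using Suc.prems(1) P True e(2) that by (cases B) force+
      then have "takeWhile (\<lambda>p. fst (snd p) \<noteq> n) (A @ B) = A" "dropWhile (\<lambda>p. fst (snd p) \<noteq> n) (A @ B) = B"
        using True e(2) by (cases B; simp add: takeWhile_append2 dropWhile_append2)+
      then show ?thesis
        using c \<open>v \<noteq> []\<close> hd True v(2) P x_eq e(1) len by simp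
    qed
    ultimately show ?thesis
      by blast
  next
    case False
    \<comment> \<open>The bar is forced for color 0: unbarred, \<open>c\<close> may not exceed
      \<open>hd v\<close> in absolute value; barred with equality, it would be inserted by the other
      rule.\<close>
    define c :: letter where "c = (u, e, e = 0 \<and> v \<noteq> [] \<and> labs (hd v) < u)"
    have c: "labs c = u" "lcol c = e" "lbar c \<longleftrightarrow> e = 0 \<and> v \<noteq> [] \<and> labs (hd v) < u"
      by (simp_all add: c_def labs_def lcol_def lbar_def)
    have "banner l (c # v)"
      using v(1) c bounds
      by (auto simp: banner_def successively_Cons valid_letter_def follows_ok_def)
    moreover have "arrange (c # v) = P"
    proof -
      have "\<forall>p\<in>set A. u \<le> fst p"
        using no_drop_sorted[OF Suc.prems(3)] P x_eq by (auto simp: sorted_wrt_append)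
      moreover have "B = [] \<or> fst (hd B) < u"
        using False x_hd x_eq by (cases "B = []") (auto simp: no_drop_def)
      ultimately have "takeWhile (\<lambda>p. u \<le> fst p) (A @ B) = A" "dropWhile (\<lambda>p. u \<le> fst p) (A @ B) = B"
        by (cases B; simp add: takeWhile_append2 dropWhile_append2)+
      moreover have "\<not> (lbar c \<and> v \<noteq> [] \<and> labs c = labs (hd v))"
        using c by auto
      ultimately show ?thesis
        using c(1,2) v(2) P x_eq len by (simp only: arrange.simps Let_def if_False)
    qed
    ultimately show ?thesis
      by blast
  qed
qed

section \<open>Colored permutations paired with their sequences\<close>

lemma length_filter_eq_count: "length (filter (\<lambda>x. f x = a) xs) = count (mset (map f xs)) a"
  by (induction xs) auto

text \<open>With 0-based positions and no truncated subtraction, the exempt drops are the 0-colored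
  ones by exactly one, as in \<open>no_drop\<close>.\<close>

lemma DES_ge2_Suc_iff:
  "Suc j \<in> DES_ge2 \<pi> \<longleftrightarrow> Suc j < length \<pi> \<and> fst (\<pi> ! Suc j) < fst (\<pi> ! j) \<and>
     \<not> (snd (\<pi> ! j) = 0 \<and> fst (\<pi> ! j) = Suc (fst (\<pi> ! Suc j)))"
  by (auto simp: DES_ge2_def)

text \<open>The set counted by \<open>Fcoeff\<close>, named so that it can serve as a fibre of a
  \<open>SIGMA\<close>.\<close>

definition F_sequences :: "nat \<Rightarrow> nat set \<Rightarrow> (nat \<Rightarrow> nat) \<Rightarrow> nat list set" where
  "F_sequences n S \<alpha> = {i. length i = n
      \<and> (\<forall>j. Suc j < n \<longrightarrow> i ! j \<ge> i ! Suc j \<and> (Suc j \<in> S \<longrightarrow> i ! j > i ! Suc j))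
      \<and> (\<forall>j<n. i ! j \<ge> 1)
      \<and> (\<forall>u. count (mset i) u = \<alpha> u)}"

text \<open>All members are orderings of one multiset, the one with multiplicities
  \<open>\<alpha>\<close>.\<close>

lemma finite_F_sequences: "finite (F_sequences n S \<alpha>)"
proof (cases "F_sequences n S \<alpha> = {}")
  case False
  then obtain i where "i \<in> F_sequences n S \<alpha>"
    by blast
  then have "F_sequences n S \<alpha> \<subseteq> {j. mset j = mset i}"
    by (auto simp: F_sequences_def intro: multiset_eqI)
  then show ?thesis
    using mset_eq_finite finite_subset by blast
qed simp

lemma finite_cperms: "finite (cperms l n)"
proof (rule finite_subset)
  show "cperms l n \<subseteq> {\<pi>. set \<pi> \<subseteq> {1..n} \<times> {..<l} \<and> length \<pi> = n}"
    by (force simp: cperms_def)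
qed (simp add: finite_lists_length_eq)

text \<open>Strictness at the positions in \<open>DES_ge2\<close> says that equal first components
  allow only exempt drops, which is \<open>no_drop\<close>. This puts pairs
  \<open>(\<pi>, i)\<close> into the form required by \<open>arrange_surj\<close>.\<close>

lemma no_drop_iff_F_sequence:
  assumes "length P = n"
  shows "map snd P \<in> cperms l n \<and> map fst P \<in> F_sequences n (DES_ge2 (map snd P)) \<alpha> \<longleftrightarrow>
    distinct (map (fst \<circ> snd) P) \<and> (fst \<circ> snd) ` set P = {1..n} \<and> successively no_drop P
    \<and> (\<forall>p\<in>set P. 1 \<le> fst p \<and> snd (snd p) < l) \<and> (\<forall>u. count (mset (map fst P)) u = \<alpha> u)"
proof -
  have "successively no_drop P \<longleftrightarrow> (\<forall>j. Suc j < n \<longrightarrow> map fst P ! j \<ge> map fst P ! Suc j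
      \<and> (Suc j \<in> DES_ge2 (map snd P) \<longrightarrow> map fst P ! j > map fst P ! Suc j))"
    using assms unfolding successively_conv_nth no_drop_def
    by (auto simp: DES_ge2_Suc_iff)
  moreover have "(\<forall>j<n. map fst P ! j \<ge> 1) \<longleftrightarrow> (\<forall>p\<in>set P. 1 \<le> fst p)"
    using assms by (auto simp: all_set_conv_all_nth)
  ultimately show ?thesis
    using assms unfolding cperms_def F_sequences_def by (auto simp: image_comp)
qed

section \<open>The counting identity\<close>

theorem theorem5p1:
  fixes l n k :: nat and \<beta> \<alpha> :: "nat \<Rightarrow> nat"
  assumes "l \<ge> 1" and "n \<ge> 1"
  shows "Qcoeff l n k \<beta> \<alpha> =
    (\<Sum>\<pi>\<in>{\<pi>\<in>cperms l n. inv_lt2 \<pi> = k \<and> (\<forall>m\<in>{1..<l}. col m \<pi> = \<beta> m)}.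
        Fcoeff n (DES_ge2 \<pi>) \<alpha>)"
proof -
  let ?A = "{\<pi>\<in>cperms l n. inv_lt2 \<pi> = k \<and> (\<forall>m\<in>{1..<l}. col m \<pi> = \<beta> m)}"
  let ?W = "{w. banner l w \<and> length w = n \<and> length (filter lbar w) = k
     \<and> (\<forall>m\<in>{1..<l}. length (filter (\<lambda>c. lcol c = m) w) = \<beta> m)
     \<and> (\<forall>u. length (filter (\<lambda>c. labs c = u) w) = \<alpha> u)}"
  let ?S = "SIGMA \<pi>:?A. F_sequences n (DES_ge2 \<pi>) \<alpha>"
  let ?unzip = "\<lambda>P :: (nat \<times> nat \<times> nat) list. (map snd P, map fst P)"
  let ?f = "\<lambda>w. ?unzip (arrange w)"
  have unzip_inj: "P = P'" if "?unzip P = ?unzip P'" for P P'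
    using that by (metis prod.inject zip_map_fst_snd)
  \<comment> \<open>The statistics match under \<open>arrange\<close>: inversions count bars, while
    colors and content are read off the multiset of \<open>mset_arrange\<close>.\<close>
  have mem: "?f w \<in> ?S \<longleftrightarrow> w \<in> ?W" if "banner l w" "length w = n" for w
  proof -
    have "map snd (arrange w) \<in> cperms l n \<and>
        map fst (arrange w) \<in> F_sequences n (DES_ge2 (map snd (arrange w))) \<alpha> \<longleftrightarrow>
      (\<forall>u. length (filter (\<lambda>c. labs c = u) w) = \<alpha> u)"
    proof -
      have pairs: "(\<lambda>p. (fst p, snd (snd p))) ` set (arrange w) = (\<lambda>c. (labs c, lcol c)) ` set w"
        using mset_arrange[of w] by (metis mset_eq_setD set_map)
      have "1 \<le> fst p \<and> snd (snd p) < l" if p: "p \<in> set (arrange w)" for p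
      proof -
        have "(fst p, snd (snd p)) \<in> (\<lambda>c. (labs c, lcol c)) ` set w"
          using p pairs by blast
        then show ?thesis
          using \<open>banner l w\<close> by (auto simp: banner_def valid_letter_def)
      qed
      moreover have "mset (map fst (arrange w)) = mset (map labs w)"
        using arg_cong[OF mset_arrange[of w], of "image_mset fst"] by (simp add: multiset.map_comp o_def)
      ultimately show ?thesis
        using that arrange_values[of w] no_drop_arrange[of l w]
        by (subst no_drop_iff_F_sequence) (auto simp: length_filter_eq_count)
    qed
    moreover have "col m (map snd (arrange w)) = length (filter (\<lambda>c. lcol c = m) w)" for m
    proof -
      have "mset (map snd (map snd (arrange w))) = mset (map lcol w)"
        using arg_cong[OF mset_arrange[of w], of "image_mset snd"] by (simp add: multiset.map_comp o_def)
      then show ?thesis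
        unfolding col_def length_filter_eq_count by simp
    qed
    ultimately show ?thesis
      using that inv_lt2_arrange[of l w] by auto
  qed
  have "bij_betw ?f ?W ?S"
  proof (rule bij_betw_imageI)
    show "inj_on ?f ?W"
      using arrange_inject unzip_inj by (intro inj_onI) blast
    show "?f ` ?W = ?S"
    proof (intro equalityI subsetI)
      fix x assume x: "x \<in> ?S"
      then obtain \<pi> i where \<pi>: "x = (\<pi>, i)" "\<pi> \<in> cperms l n" "i \<in> F_sequences n (DES_ge2 \<pi>) \<alpha>"
        by auto
      \<comment> \<open>Zipping undoes \<open>?unzip\<close>, so \<open>arrange_surj\<close> yields
        a banner for the given pair.\<close>
      define P where "P = zip i \<pi>"
      have len: "length i = n" "length \<pi> = n"
        using \<pi> by (auto simp: F_sequences_def cperms_def)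
      then have unzip: "?unzip P = x" and "length P = n"
        by (simp_all add: P_def \<pi>)
      then obtain w where w: "banner l w" "arrange w = P"
        using arrange_surj[of P n l] no_drop_iff_F_sequence[of P n l \<alpha>] \<pi> by auto
      then have "length w = n"
        using \<open>length P = n\<close> by (metis length_arrange)
      then have "w \<in> ?W"
        using mem[of w] w x unzip by simp
      then show "x \<in> ?f ` ?W"
        using w unzip by blast
    qed (use mem in auto)
  qed
  then have "card ?W = card ?S"
    by (rule bij_betw_same_card)
  also have "\<dots> = (\<Sum>\<pi>\<in>?A. card (F_sequences n (DES_ge2 \<pi>) \<alpha>))"
    using finite_cperms finite_F_sequences by (intro card_SigmaI) auto
  finally show ?thesis
    unfolding Qcoeff_eq_card_banners Fcoeff_def F_sequences_def .
qed

end
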